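(* Let $F=\langle X,D,C\rangle$ be any CSP instance and $s_F:X\times D\to\mathbb{R}_{>0}$ any positive and unitary weighting seed. Let $d_F=s_F$ and let $w_F$ be the weights built from $s_F$ and $d_F$, i.e. $w_F(\sigma,x)=\omega_F(x,\sigma(x),A_F(\sigma,x))$ with $$\omega_F(x,a,\Delta)=\begin{cases}s_F(x,a)+\dfrac{d_F(x,a)}{\sum_{b\in\Delta}d_F(x,b)}\displaystyle\sum_{b\in D\setminus\Delta}s_F(x,b)&\text{if }a\in\Delta,\\0&\text{otherwise.}\end{cases}$$ Then there exists an (instance dependent) orientation $\prec_F$ on $\mathcal{S}(F)$ induced by a set $\{(x,<_{F,x})\}_{x\in X}$ of total strict orders on $D$ such that $$|\mathcal{M}_{\prec_F}(F)|\le W_F(\mathcal{S}(F)).$$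
   Context: A CSP instance is a triple $F=\langle X,D,C\rangle$ with $X$ a finite set of variables, $D$ a finite domain of values, and $C$ a set of constraints; a constraint is a pair $\langle (x_1,\dots,x_k),R\rangle$ with $(x_1,\dots,x_k)\in X^k$, $R\subseteq D^k$, for some integer $k$. A valuation is a map $v\in D^X$; it satisfies the constraint iff $(v(x_1),\dots,v(x_k))\in R$. A solution of $F$ is a valuation satisfying all constraints; $\mathcal{S}(F)$ is the set of solutions. Two solutions are $x$-adjacent if they agree on all variables other than $x$ (each solution is $x$-adjacent to itself). $A_F(\sigma,x)$ is the set of values $\tau(x)$ over all solutions $\tau$ that are $x$-adjacent to $\sigma$. A seed $s_F$ is unitary iff $\sum_{a\in D}s_F(x,a)=1$ for all $x\in X$. $W_F(\sigma)=\prod_{x\in X}w_F(\sigma,x)$ and $W_F(S)=\sum_{\sigma\in S}W_F(\sigma)$ for a set $S$ of solutions. Given for each $x\in X$ a total strict order $<_{F,x}$ on $D$, the orientation $\prec_F$ on $\mathcal{S}(F)$ induced by $\{(x,<_{F,x})\}_{x\in X}$ is the relation: $\sigma\prec_F\tau$ iff, for some $x\in X$, $\sigma$ and $\tau$ are distinct, $x$-adjacent and $\sigma(x)<_{F,x}\tau(x)$. $\mathcal{M}_{\prec_F}(F)$ is the set of minimal solutions, i.e. solutions $\sigma$ for which there is no solution $\tau$ with $\tau\prec_F\sigma$. *)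

theory Defs
  imports Complex_Main "HOL-Library.FuncSet"
begin

text \<open>A constraint of arity \<open>k\<close> is a list of \<open>k\<close> variables (repetitions allowed) together with a
  set of lists of \<open>k\<close> values.\<close>

record ('x, 'd) csp =
  csp_vars :: "'x set"
  csp_dom :: "'d set"
  csp_cons :: "('x list \<times> 'd list set) set"

definition csp_instance :: "('x, 'd) csp \<Rightarrow> bool" where
  "csp_instance F \<longleftrightarrow>
     finite (csp_vars F) \<and> finite (csp_dom F) \<and>
     (\<forall>(xs, R) \<in> csp_cons F.
        set xs \<subseteq> csp_vars F \<and>
        R \<subseteq> {vs. set vs \<subseteq> csp_dom F \<and> length vs = length xs})"

text \<open>Valuations are extensional functions, so that each map from the variables to the values
  is represented exactly once (this matters for cardinalities).\<close>

definition valuations :: "('x, 'd) csp \<Rightarrow> ('x \<Rightarrow> 'd) set" where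
  "valuations F = csp_vars F \<rightarrow>\<^sub>E csp_dom F"

definition satisfies :: "('x \<Rightarrow> 'd) \<Rightarrow> 'x list \<times> 'd list set \<Rightarrow> bool" where
  "satisfies v c \<longleftrightarrow> map v (fst c) \<in> snd c"

definition solutions :: "('x, 'd) csp \<Rightarrow> ('x \<Rightarrow> 'd) set" where
  "solutions F = {v \<in> valuations F. \<forall>c \<in> csp_cons F. satisfies v c}"

definition adjacent :: "('x, 'd) csp \<Rightarrow> 'x \<Rightarrow> ('x \<Rightarrow> 'd) \<Rightarrow> ('x \<Rightarrow> 'd) \<Rightarrow> bool" where
  "adjacent F x \<sigma> \<tau> \<longleftrightarrow>
     \<sigma> \<in> solutions F \<and> \<tau> \<in> solutions F \<and> (\<forall>y \<in> csp_vars F - {x}. \<sigma> y = \<tau> y)"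

definition adjacent_values :: "('x, 'd) csp \<Rightarrow> ('x \<Rightarrow> 'd) \<Rightarrow> 'x \<Rightarrow> 'd set" where
  "adjacent_values F \<sigma> x = {\<tau> x | \<tau>. adjacent F x \<sigma> \<tau>}"

definition positive_seed :: "('x, 'd) csp \<Rightarrow> ('x \<Rightarrow> 'd \<Rightarrow> real) \<Rightarrow> bool" where
  "positive_seed F s \<longleftrightarrow> (\<forall>x \<in> csp_vars F. \<forall>a \<in> csp_dom F. s x a > 0)"

definition unitary_seed :: "('x, 'd) csp \<Rightarrow> ('x \<Rightarrow> 'd \<Rightarrow> real) \<Rightarrow> bool" where
  "unitary_seed F s \<longleftrightarrow> (\<forall>x \<in> csp_vars F. (\<Sum>a \<in> csp_dom F. s x a) = 1)"

definition omega ::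
  "('x, 'd) csp \<Rightarrow> ('x \<Rightarrow> 'd \<Rightarrow> real) \<Rightarrow> ('x \<Rightarrow> 'd \<Rightarrow> real) \<Rightarrow> 'x \<Rightarrow> 'd \<Rightarrow> 'd set \<Rightarrow> real" where
  "omega F s d x a \<Delta> =
     (if a \<in> \<Delta>
      then s x a + d x a / (\<Sum>b \<in> \<Delta>. d x b) * (\<Sum>b \<in> csp_dom F - \<Delta>. s x b)
      else 0)"

definition var_weight ::
  "('x, 'd) csp \<Rightarrow> ('x \<Rightarrow> 'd \<Rightarrow> real) \<Rightarrow> ('x \<Rightarrow> 'd \<Rightarrow> real) \<Rightarrow> ('x \<Rightarrow> 'd) \<Rightarrow> 'x \<Rightarrow> real" where
  "var_weight F s d \<sigma> x = omega F s d x (\<sigma> x) (adjacent_values F \<sigma> x)"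

definition solution_weight ::
  "('x, 'd) csp \<Rightarrow> ('x \<Rightarrow> 'd \<Rightarrow> real) \<Rightarrow> ('x \<Rightarrow> 'd \<Rightarrow> real) \<Rightarrow> ('x \<Rightarrow> 'd) \<Rightarrow> real" where
  "solution_weight F s d \<sigma> = (\<Prod>x \<in> csp_vars F. var_weight F s d \<sigma> x)"

definition total_weight ::
  "('x, 'd) csp \<Rightarrow> ('x \<Rightarrow> 'd \<Rightarrow> real) \<Rightarrow> ('x \<Rightarrow> 'd \<Rightarrow> real) \<Rightarrow> ('x \<Rightarrow> 'd) set \<Rightarrow> real" where
  "total_weight F s d S = (\<Sum>\<sigma> \<in> S. solution_weight F s d \<sigma>)"

text \<open>The library's \<open>strict_linear_order_on\<close> does not confine the relation to the carrier.\<close>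

definition total_strict_order_on :: "'d set \<Rightarrow> 'd rel \<Rightarrow> bool" where
  "total_strict_order_on D r \<longleftrightarrow> r \<subseteq> D \<times> D \<and> strict_linear_order_on D r"

definition orientation :: "('x, 'd) csp \<Rightarrow> ('x \<Rightarrow> 'd rel) \<Rightarrow> ('x \<Rightarrow> 'd) rel" where
  "orientation F lt =
     {(\<sigma>, \<tau>). \<exists>x \<in> csp_vars F. \<sigma> \<noteq> \<tau> \<and> adjacent F x \<sigma> \<tau> \<and> (\<sigma> x, \<tau> x) \<in> lt x}"

definition minimal_solutions :: "('x, 'd) csp \<Rightarrow> ('x \<Rightarrow> 'd) rel \<Rightarrow> ('x \<Rightarrow> 'd) set" where
  "minimal_solutions F prec =
     {\<sigma> \<in> solutions F. \<not> (\<exists>\<tau> \<in> solutions F. (\<tau>, \<sigma>) \<in> prec)}"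

end

theory Submission
  imports Defs
begin

text \<open>
  For \<open>d = s\<close> and a unitary seed the weight of \<open>\<sigma>\<close> at \<open>x\<close> is \<open>s(x, \<sigma>(x)) / s(x, A\<^sub>F(\<sigma>, x))\<close>. This is
  the probability that \<open>\<sigma>(x)\<close> comes first among the values of \<open>A\<^sub>F(\<sigma>, x)\<close> when the order on \<open>D\<close> is
  drawn by successive sampling without replacement with probabilities proportional to \<open>s(x, -)\<close>.
  Drawing the orders independently for all variables, \<open>W\<^sub>F(S(F))\<close> is the expected number of minimal
  solutions, so some choice of orders has at most that many. The expectation is derandomised:
  the orders are fixed one variable at a time, and each order one value at a time, without ever
  increasing the conditional expectation.
\<close>

lemma exists_le_weighted_average:
  fixes s g :: "'d \<Rightarrow> real"
  assumes "finite D" "D \<noteq> {}" and pos: "\<And>e. e \<in> D \<Longrightarrow> s e > 0"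
    and avg: "(\<Sum>e\<in>D. s e * g e) = sum s D * t"
  shows "\<exists>e\<in>D. g e \<le> t"
proof (rule ccontr)
  assume "\<not> (\<exists>e\<in>D. g e \<le> t)"
  then have "(\<Sum>e\<in>D. s e * t) < (\<Sum>e\<in>D. s e * g e)"
    using assms by (intro sum_strict_mono) (auto simp: not_le)
  then show False
    using avg by (simp add: sum_distrib_right)
qed

lemma total_strict_order_on_insert_least:
  assumes r: "total_strict_order_on (D - {e}) r" and "e \<in> D"
  shows "total_strict_order_on D (r \<union> {e} \<times> (D - {e}))"
  using assms unfolding total_strict_order_on_def strict_linear_order_on_def
  by (auto simp: trans_def irrefl_def total_on_def; blast)

text \<open>Induction on \<open>D\<close>, choosing the least value \<open>e\<close> first and
  ordering \<open>D - {e}\<close> afterwards. An index with \<open>a i = e\<close> is then won, one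
  with \<open>e\<close> among the other values of \<open>\<Delta> i\<close> is lost, and one with
  \<open>e\<close> outside \<open>\<Delta> i\<close> keeps its ratio
  \<open>s (a i) / sum s (\<Delta> i)\<close>, which does not mention the rest of \<open>D\<close>.
  Only indices of the last kind pass to the smaller domain, so \<open>I\<close> varies in the
  induction.\<close>

lemma exists_order_sum_minimal_le:
  fixes s :: "'d \<Rightarrow> real" and c :: "'i \<Rightarrow> real"
  assumes "finite D" "finite I" "\<And>e. e \<in> D \<Longrightarrow> s e > 0"
    and "\<And>i. i \<in> I \<Longrightarrow> a i \<in> \<Delta> i \<and> \<Delta> i \<subseteq> D"
  shows "\<exists>r. total_strict_order_on D r \<and>
     (\<Sum>i\<in>I. c i * of_bool (\<forall>b\<in>\<Delta> i. (b, a i) \<notin> r)) \<le> (\<Sum>i\<in>I. c i * (s (a i) / sum s (\<Delta> i)))"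
  using assms
proof (induction D arbitrary: I rule: finite_psubset_induct)
  case (psubset D)
  define p where "p i = s (a i) / sum s (\<Delta> i)" for i
  show ?case
  proof (cases "D = {}")
    case True
    with psubset.prems have "I = {}" by auto
    moreover have "total_strict_order_on D {}"
      by (simp add: True total_strict_order_on_def strict_linear_order_on_def irrefl_def)
    ultimately show ?thesis by auto
  next
    case False
    \<comment> \<open>The conditional probability that \<open>a i\<close> comes first in
      \<open>\<Delta> i\<close>, given that \<open>e\<close> is the least value of
      \<open>D\<close>.\<close>
    define q where "q e i = (of_bool (a i = e) + of_bool (e \<notin> \<Delta> i) * p i :: real)" for e i
    \<comment> \<open>Law of total probability over the least value, multiplied through by
      \<open>sum s D\<close> because the seed restricted to a smaller domain no longer sums to
      1.\<close>
    have q_avg: "(\<Sum>e\<in>D. s e * q e i) = sum s D * p i" if "i \<in> I" for i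
    proof -
      have i: "a i \<in> \<Delta> i" "\<Delta> i \<subseteq> D" using psubset.prems that by auto
      have pos: "sum s (\<Delta> i) > 0"
        using i psubset.hyps psubset.prems by (intro sum_pos) (auto dest: finite_subset)
      have "(\<Sum>e\<in>D. s e * q e i) =
          (\<Sum>e\<in>D. if e = a i then s e else 0) + (\<Sum>e\<in>D. if e \<notin> \<Delta> i then s e else 0) * p i"
        unfolding q_def sum_distrib_right sum.distrib [symmetric]
        by (intro sum.cong) (auto simp: algebra_simps)
      also have "\<dots> = s (a i) + sum s (D - \<Delta> i) * p i"
        using i psubset.hyps by (auto simp: sum.If_cases Diff_eq Compl_eq)
      also have "\<dots> = s (a i) + (sum s D - sum s (\<Delta> i)) * p i"
        using i psubset.hyps by (simp add: sum_diff)
      also have "\<dots> = sum s D * p i"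
        using pos by (simp add: p_def field_simps)
      finally show ?thesis .
    qed
    have "(\<Sum>e\<in>D. s e * (\<Sum>i\<in>I. c i * q e i)) = (\<Sum>i\<in>I. c i * (\<Sum>e\<in>D. s e * q e i))"
      by (simp add: sum_distrib_left mult.left_commute sum.swap [of _ D I])
    also have "\<dots> = sum s D * (\<Sum>i\<in>I. c i * p i)"
      using q_avg by (simp add: sum_distrib_left mult.left_commute)
    finally have avg: "(\<Sum>e\<in>D. s e * (\<Sum>i\<in>I. c i * q e i)) = sum s D * (\<Sum>i\<in>I. c i * p i)" .
    \<comment> \<open>The conditional expectations average to the unconditional one, so some
      \<open>e\<close> does not exceed it.\<close>
    obtain e where e: "e \<in> D" "(\<Sum>i\<in>I. c i * q e i) \<le> (\<Sum>i\<in>I. c i * p i)"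
      using exists_le_weighted_average [OF psubset.hyps False psubset.prems(2) avg] by blast
    \<comment> \<open>The indices that the choice of \<open>e\<close> leaves undecided.\<close>
    define J where "J = {i\<in>I. e \<notin> \<Delta> i}"
    have "\<exists>r. total_strict_order_on (D - {e}) r \<and>
        (\<Sum>i\<in>J. c i * of_bool (\<forall>b\<in>\<Delta> i. (b, a i) \<notin> r)) \<le> (\<Sum>i\<in>J. c i * p i)"
      unfolding p_def using e psubset.prems by (intro psubset.IH) (auto simp: J_def)
    then obtain r where r: "total_strict_order_on (D - {e}) r"
      and r_le: "(\<Sum>i\<in>J. c i * of_bool (\<forall>b\<in>\<Delta> i. (b, a i) \<notin> r)) \<le> (\<Sum>i\<in>J. c i * p i)"
      by blast
    have r_sub: "r \<subseteq> (D - {e}) \<times> (D - {e})"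
      using r by (simp add: total_strict_order_on_def)
    let ?r = "r \<union> {e} \<times> (D - {e})"
    \<comment> \<open>The two summands exclude each other: \<open>a i = e\<close> puts
      \<open>e\<close> into \<open>\<Delta> i\<close>, hence \<open>i\<close> outside
      \<open>J\<close>. Nothing lies below \<open>e\<close> in the new order, because
      \<open>r\<close> lives on \<open>D - {e}\<close>.\<close>
    have split: "(of_bool (\<forall>b\<in>\<Delta> i. (b, a i) \<notin> ?r) :: real) = of_bool (a i = e) +
        of_bool (i \<in> J) * of_bool (\<forall>b\<in>\<Delta> i. (b, a i) \<notin> r)" if "i \<in> I" for i
      using psubset.prems(3) [OF that] that r_sub by (auto simp: J_def)
    have sum_J: "(\<Sum>i\<in>I. c i * (of_bool (i \<in> J) * f i)) = (\<Sum>i\<in>J. c i * f i)" for f :: "'i \<Rightarrow> real"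
      using psubset.prems by (intro sum.mono_neutral_cong_right) (auto simp: J_def)
    have "(\<Sum>i\<in>I. c i * of_bool (\<forall>b\<in>\<Delta> i. (b, a i) \<notin> ?r)) =
        (\<Sum>i\<in>I. c i * of_bool (a i = e)) + (\<Sum>i\<in>J. c i * of_bool (\<forall>b\<in>\<Delta> i. (b, a i) \<notin> r))"
      unfolding sum_J [symmetric] sum.distrib [symmetric]
      by (intro sum.cong refl) (simp only: split distrib_left)
    also have "\<dots> \<le> (\<Sum>i\<in>I. c i * of_bool (a i = e)) + (\<Sum>i\<in>J. c i * p i)"
      using r_le by simp
    also have "\<dots> = (\<Sum>i\<in>I. c i * q e i)"
      unfolding sum_J [symmetric] sum.distrib [symmetric]
      by (intro sum.cong refl) (simp add: q_def J_def distrib_left)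
    finally show ?thesis
      using e total_strict_order_on_insert_least [OF r] unfolding p_def by fastforce
  qed
qed

text \<open>Independence turns the probability for all variables into a product, so the variables
  can be treated one by one, the factors of the others being absorbed into the coefficients. This is
  why \<open>c\<close> is arbitrary in the induction.\<close>

lemma exists_orders_sum_prod_minimal_le:
  fixes s :: "'x \<Rightarrow> 'd \<Rightarrow> real" and c :: "'i \<Rightarrow> real"
  assumes "finite V" "finite D" "finite I"
    and "\<And>x e. x \<in> V \<Longrightarrow> e \<in> D \<Longrightarrow> s x e > 0"
    and "\<And>x i. x \<in> V \<Longrightarrow> i \<in> I \<Longrightarrow> a x i \<in> \<Delta> x i \<and> \<Delta> x i \<subseteq> D"
  shows "\<exists>lt. (\<forall>x\<in>V. total_strict_order_on D (lt x)) \<and>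
     (\<Sum>i\<in>I. c i * (\<Prod>x\<in>V. of_bool (\<forall>b\<in>\<Delta> x i. (b, a x i) \<notin> lt x)))
       \<le> (\<Sum>i\<in>I. c i * (\<Prod>x\<in>V. s x (a x i) / sum (s x) (\<Delta> x i)))"
  using assms(1,4,5)
proof (induction V arbitrary: c rule: finite_induct)
  case empty
  then show ?case by simp
next
  case (insert x V)
  define p where "p y i = s y (a y i) / sum (s y) (\<Delta> y i)" for y i
  \<comment> \<open>The order of \<open>x\<close> is chosen while the variables in \<open>V\<close>
    still count with their probabilities.\<close>
  have "\<exists>r. total_strict_order_on D r \<and>
      (\<Sum>i\<in>I. (c i * (\<Prod>y\<in>V. p y i)) * of_bool (\<forall>b\<in>\<Delta> x i. (b, a x i) \<notin> r))
        \<le> (\<Sum>i\<in>I. (c i * (\<Prod>y\<in>V. p y i)) * p x i)"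
    unfolding p_def [of x] using assms(2,3) insert.prems
    by (intro exists_order_sum_minimal_le) auto
  then obtain r where r: "total_strict_order_on D r"
    and r_le: "(\<Sum>i\<in>I. (c i * (\<Prod>y\<in>V. p y i)) * of_bool (\<forall>b\<in>\<Delta> x i. (b, a x i) \<notin> r))
        \<le> (\<Sum>i\<in>I. (c i * (\<Prod>y\<in>V. p y i)) * p x i)"
    by blast
  \<comment> \<open>With \<open>r\<close> fixed, the outcome at \<open>x\<close> is a 0-1 factor of
    the coefficient, and the induction hypothesis orders the values for \<open>V\<close>.\<close>
  have "\<exists>lt. (\<forall>y\<in>V. total_strict_order_on D (lt y)) \<and>
      (\<Sum>i\<in>I. (c i * of_bool (\<forall>b\<in>\<Delta> x i. (b, a x i) \<notin> r)) *
          (\<Prod>y\<in>V. of_bool (\<forall>b\<in>\<Delta> y i. (b, a y i) \<notin> lt y)))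
        \<le> (\<Sum>i\<in>I. (c i * of_bool (\<forall>b\<in>\<Delta> x i. (b, a x i) \<notin> r)) * (\<Prod>y\<in>V. p y i))"
    unfolding p_def using insert.prems by (intro insert.IH) auto
  then obtain lt where lt: "\<forall>y\<in>V. total_strict_order_on D (lt y)"
    and lt_le: "(\<Sum>i\<in>I. (c i * of_bool (\<forall>b\<in>\<Delta> x i. (b, a x i) \<notin> r)) *
          (\<Prod>y\<in>V. of_bool (\<forall>b\<in>\<Delta> y i. (b, a y i) \<notin> lt y)))
        \<le> (\<Sum>i\<in>I. (c i * of_bool (\<forall>b\<in>\<Delta> x i. (b, a x i) \<notin> r)) * (\<Prod>y\<in>V. p y i))"
    by blast
  let ?lt = "lt(x := r)"
  have V: "(\<Prod>y\<in>V. of_bool (\<forall>b\<in>\<Delta> y i. (b, a y i) \<notin> ?lt y) :: real) =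
      (\<Prod>y\<in>V. of_bool (\<forall>b\<in>\<Delta> y i. (b, a y i) \<notin> lt y))" for i
    using insert.hyps by (intro prod.cong) auto
  have "(\<Sum>i\<in>I. c i * (\<Prod>y\<in>insert x V. of_bool (\<forall>b\<in>\<Delta> y i. (b, a y i) \<notin> ?lt y))) =
      (\<Sum>i\<in>I. (c i * of_bool (\<forall>b\<in>\<Delta> x i. (b, a x i) \<notin> r)) *
          (\<Prod>y\<in>V. of_bool (\<forall>b\<in>\<Delta> y i. (b, a y i) \<notin> lt y)))"
    by (simp only: prod.insert [OF insert.hyps] V fun_upd_same mult.assoc)
  also note lt_le
  also have "(\<Sum>i\<in>I. (c i * of_bool (\<forall>b\<in>\<Delta> x i. (b, a x i) \<notin> r)) * (\<Prod>y\<in>V. p y i)) =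
      (\<Sum>i\<in>I. (c i * (\<Prod>y\<in>V. p y i)) * of_bool (\<forall>b\<in>\<Delta> x i. (b, a x i) \<notin> r))"
    by (simp only: mult_ac)
  also note r_le
  also have "(\<Sum>i\<in>I. (c i * (\<Prod>y\<in>V. p y i)) * p x i) =
      (\<Sum>i\<in>I. c i * (\<Prod>y\<in>insert x V. p y i))"
    using insert.hyps by (simp add: mult_ac)
  finally have "(\<Sum>i\<in>I. c i * (\<Prod>y\<in>insert x V. of_bool (\<forall>b\<in>\<Delta> y i. (b, a y i) \<notin> ?lt y)))
      \<le> (\<Sum>i\<in>I. c i * (\<Prod>y\<in>insert x V. p y i))" .
  moreover have "\<forall>y\<in>insert x V. total_strict_order_on D (?lt y)"
    using r lt by simp
  ultimately show ?case unfolding p_def by blast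
qed

lemma finite_solutions: "csp_instance F \<Longrightarrow> finite (solutions F)"
  unfolding solutions_def valuations_def csp_instance_def
  by (auto intro!: finite_PiE)

lemma adjacent_values_subset_dom:
  "x \<in> csp_vars F \<Longrightarrow> adjacent_values F \<sigma> x \<subseteq> csp_dom F"
  by (auto simp: adjacent_values_def adjacent_def solutions_def valuations_def)

lemma solution_value_in_adjacent_values:
  "\<sigma> \<in> solutions F \<Longrightarrow> \<sigma> x \<in> adjacent_values F \<sigma> x"
  by (auto simp: adjacent_values_def adjacent_def)

text \<open>A smaller adjacent value is taken by some \<open>\<tau>\<close> that is
  \<open>x\<close>-adjacent to \<open>\<sigma>\<close>. Irreflexivity makes \<open>\<tau>\<close>
  distinct from \<open>\<sigma>\<close>, as \<open>orientation\<close> demands, so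
  \<open>\<tau>\<close> would precede \<open>\<sigma>\<close>.\<close>

lemma minimal_solution_value_minimal:
  assumes "\<sigma> \<in> minimal_solutions F (orientation F lt)" "x \<in> csp_vars F" "irrefl (lt x)"
    and "b \<in> adjacent_values F \<sigma> x"
  shows "(b, \<sigma> x) \<notin> lt x"
proof
  assume b: "(b, \<sigma> x) \<in> lt x"
  obtain \<tau> where \<tau>: "b = \<tau> x" "adjacent F x \<sigma> \<tau>"
    using assms(4) by (auto simp: adjacent_values_def)
  have "\<tau> \<noteq> \<sigma>"
    using b \<tau> assms(3) by (auto simp: irrefl_def)
  moreover have "\<tau> \<in> solutions F" "adjacent F x \<tau> \<sigma>"
    using \<tau> by (auto simp: adjacent_def)
  ultimately show False
    using assms(1,2) b \<tau> by (auto simp: minimal_solutions_def orientation_def)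
qed

text \<open>If the adjacent values have total seed S, those outside have 1 - S, and s + (s / S) (1 -
  S) = s / S.\<close>

lemma var_weight_unitary:
  assumes F: "csp_instance F" "positive_seed F s" "unitary_seed F s"
    and \<sigma>: "\<sigma> \<in> solutions F" and x: "x \<in> csp_vars F"
  shows "var_weight F s s \<sigma> x = s x (\<sigma> x) / sum (s x) (adjacent_values F \<sigma> x)"
proof -
  let ?A = "adjacent_values F \<sigma> x"
  note sub = adjacent_values_subset_dom [OF x, of \<sigma>]
  note mem = solution_value_in_adjacent_values [OF \<sigma>, of x]
  have fin: "finite (csp_dom F)" "finite ?A"
    using F sub by (auto simp: csp_instance_def dest: finite_subset)
  have pos: "sum (s x) ?A > 0"
    using F x sub mem fin by (intro sum_pos) (auto simp: positive_seed_def)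
  have compl: "sum (s x) (csp_dom F - ?A) = 1 - sum (s x) ?A"
    using F x fin sub by (simp add: sum_diff unitary_seed_def)
  show ?thesis
    using mem pos unfolding var_weight_def omega_def compl by (simp add: field_simps)
qed

theorem theorem32:
  fixes F :: "('x, 'd) csp" and s d :: "'x \<Rightarrow> 'd \<Rightarrow> real"
  assumes "csp_instance F"
    and "positive_seed F s"
    and "unitary_seed F s"
    and "d = s"
  shows "\<exists>lt :: 'x \<Rightarrow> 'd rel.
           (\<forall>x \<in> csp_vars F. total_strict_order_on (csp_dom F) (lt x)) \<and>
           real (card (minimal_solutions F (orientation F lt)))
             \<le> total_weight F s d (solutions F)"
proof -
  let ?V = "csp_vars F" and ?D = "csp_dom F" and ?S = "solutions F"
  let ?A = "\<lambda>x \<sigma>. adjacent_values F \<sigma> x"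
  have fin: "finite ?V" "finite ?D" "finite ?S"
    using assms(1) finite_solutions by (auto simp: csp_instance_def)
  \<comment> \<open>The indices are the solutions themselves, each with coefficient 1.\<close>
  have "\<exists>lt. (\<forall>x\<in>?V. total_strict_order_on ?D (lt x)) \<and>
      (\<Sum>\<sigma>\<in>?S. 1 * (\<Prod>x\<in>?V. of_bool (\<forall>b\<in>?A x \<sigma>. (b, \<sigma> x) \<notin> lt x)))
        \<le> (\<Sum>\<sigma>\<in>?S. 1 * (\<Prod>x\<in>?V. s x (\<sigma> x) / sum (s x) (?A x \<sigma>)))"
    using fin assms(2)
    by (intro exists_orders_sum_prod_minimal_le)
       (simp_all add: positive_seed_def adjacent_values_subset_dom solution_value_in_adjacent_values)
  then obtain lt where lt: "\<forall>x\<in>?V. total_strict_order_on ?D (lt x)"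
    and le: "(\<Sum>\<sigma>\<in>?S. \<Prod>x\<in>?V. of_bool (\<forall>b\<in>?A x \<sigma>. (b, \<sigma> x) \<notin> lt x))
        \<le> (\<Sum>\<sigma>\<in>?S. \<Prod>x\<in>?V. s x (\<sigma> x) / sum (s x) (?A x \<sigma>))"
    unfolding mult_1 by blast
  let ?M = "minimal_solutions F (orientation F lt)"
  have M: "?M \<subseteq> ?S"
    by (auto simp: minimal_solutions_def)
  have irr: "irrefl (lt x)" if "x \<in> ?V" for x
    using lt that by (auto simp: total_strict_order_on_def strict_linear_order_on_def)
  have "real (card ?M) = (\<Sum>\<sigma>\<in>?M. 1)"
    by simp
  also have "\<dots> = (\<Sum>\<sigma>\<in>?M. \<Prod>x\<in>?V. of_bool (\<forall>b\<in>?A x \<sigma>. (b, \<sigma> x) \<notin> lt x))"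
  proof (rule sum.cong [OF refl])
    fix \<sigma> assume "\<sigma> \<in> ?M"
    then have "of_bool (\<forall>b\<in>?A x \<sigma>. (b, \<sigma> x) \<notin> lt x) = (1 :: real)" if "x \<in> ?V" for x
      using minimal_solution_value_minimal irr that by fastforce
    then show "1 = (\<Prod>x\<in>?V. of_bool (\<forall>b\<in>?A x \<sigma>. (b, \<sigma> x) \<notin> lt x) :: real)"
      by (intro prod.neutral [symmetric]) blast
  qed
  \<comment> \<open>The products are nonnegative, so summing over all solutions instead of the
    minimal ones can only increase the sum.\<close>
  also have "\<dots> \<le> (\<Sum>\<sigma>\<in>?S. \<Prod>x\<in>?V. of_bool (\<forall>b\<in>?A x \<sigma>. (b, \<sigma> x) \<notin> lt x))"
    using fin M by (intro sum_mono2 prod_nonneg) auto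
  also note le
  also have "(\<Sum>\<sigma>\<in>?S. \<Prod>x\<in>?V. s x (\<sigma> x) / sum (s x) (?A x \<sigma>)) = total_weight F s d ?S"
    unfolding total_weight_def solution_weight_def assms(4)
    using assms(1-3) by (intro sum.cong prod.cong refl) (simp add: var_weight_unitary)
  finally show ?thesis
    using lt by blast
qed

end
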